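(* Let $d \geq 48$ be an integer, $L = U \oplus U \oplus \langle -6 \rangle \oplus \langle -2d \rangle$, let $w$ and $v$ be generators of the summands $\langle -6\rangle$ and $\langle -2d\rangle$, $v^* = \frac{1}{2d}v$, $w^* = \frac{1}{6}w$, and $$\Gamma = \{ g \in \operatorname{O}^+(L) \mid g v^* \equiv v^* \bmod L \text{ and } g w^* \equiv \det(g)\, w^* \bmod L\}.$$ Then $|\operatorname{O}(L) : \Gamma| \leq 2880 \cdot 2^{\nu(2d)}$, where $\nu(n)$ denotes the number of distinct prime divisors of $n$.
   Context: $U$ is the hyperbolic plane, $\langle m\rangle$ the rank one lattice generated by a vector of square $m$. $\operatorname{O}^+(L) = \operatorname{O}(L) \cap \operatorname{O}^+(L\otimes \mathbb{R})$, where $\operatorname{O}^+(L\otimes\mathbb{R})$ is the kernel of the real spinor norm. $v^*,w^*$ lie in the dual lattice $L^\vee$. *)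

theory Defs
  imports "HOL-Analysis.Analysis" "HOL-Library.Numeral_Type" "HOL-Computational_Algebra.Primes"
begin

text \<open>The lattice L = U + U + <-6> + <-2d> is realised as Z^6 inside R^6 (type real^6).
  Coordinates (indices of type 6): 1,2 span the first U (e1,f1), 3,4 the second U (e2,f2),
  5 is w with w.w = -6, and 0 (= 6 in the numeral type) is v with v.v = -2d.\<close>

definition gramL :: "nat \<Rightarrow> real^6^6" where
  "gramL d = (\<chi> i j.
     if (i = 1 \<and> j = 2) \<or> (i = 2 \<and> j = 1) \<or> (i = 3 \<and> j = 4) \<or> (i = 4 \<and> j = 3) then 1
     else if i = 5 \<and> j = 5 then -6
     else if i = 0 \<and> j = 0 then - (2 * real d)
     else 0)"

definition bilL :: "nat \<Rightarrow> real^6 \<Rightarrow> real^6 \<Rightarrow> real" where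
  "bilL d x y = x \<bullet> (gramL d *v y)"

definition vecL :: "real^6" where "vecL = axis 0 1"   \<comment> \<open>generator v of <-2d>\<close>
definition vecW :: "real^6" where "vecW = axis 5 1"   \<comment> \<open>generator w of <-6>\<close>

definition int_vec :: "real^6 \<Rightarrow> bool" where
  "int_vec x \<longleftrightarrow> (\<forall>i. x $ i \<in> \<int>)"

definition int_mat :: "real^6^6 \<Rightarrow> bool" where
  "int_mat M \<longleftrightarrow> (\<forall>i j. M $ i $ j \<in> \<int>)"

text \<open>O(L): automorphisms of the lattice Z^6 (integral matrices with integral inverse)
  preserving the bilinear form.\<close>
definition OL :: "nat \<Rightarrow> (real^6^6) set" where
  "OL d = {g. int_mat g \<and> (\<exists>h. int_mat h \<and> g ** h = mat 1 \<and> h ** g = mat 1)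
              \<and> (\<forall>x y. bilL d (g *v x) (g *v y) = bilL d x y)}"

text \<open>Reflection of the real quadratic space L (x) R in a non-isotropic vector r.\<close>
definition reflL :: "nat \<Rightarrow> real^6 \<Rightarrow> real^6 \<Rightarrow> real^6" where
  "reflL d r x = x - (2 * bilL d x r / bilL d r r) *\<^sub>R r"

text \<open>Kernel of the real spinor norm on O(L (x) R), with the convention that the spinor norm
  of the reflection in r is -(r,r)/2 mod squares: g lies in the kernel iff it is a product of
  reflections in non-isotropic real vectors of which an even number have positive square.
  (For signature (2,4) this is the subgroup preserving the Hermitian symmetric domain.)\<close>
definition spinor_kernel :: "nat \<Rightarrow> (real^6^6) set" where
  "spinor_kernel d = {g. \<exists>rs. (\<forall>r\<in>set rs. bilL d r r \<noteq> 0)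
        \<and> ((*v) g) = foldr (\<circ>) (map (reflL d) rs) id
        \<and> even (length (filter (\<lambda>r. bilL d r r > 0) rs))}"

definition OplusL :: "nat \<Rightarrow> (real^6^6) set" where
  "OplusL d = OL d \<inter> spinor_kernel d"

definition GammaL :: "nat \<Rightarrow> (real^6^6) set" where
  "GammaL d = {g \<in> OplusL d.
      int_vec (g *v ((1 / (2 * real d)) *\<^sub>R vecL) - (1 / (2 * real d)) *\<^sub>R vecL)
    \<and> int_vec (g *v ((1 / 6) *\<^sub>R vecW) - (det g) *\<^sub>R ((1 / 6) *\<^sub>R vecW))}"

text \<open>Left cosets of H in G, for sets of matrices.\<close>
definition mat_cosets :: "(real^6^6) set \<Rightarrow> (real^6^6) set \<Rightarrow> (real^6^6) set set" where
  "mat_cosets G H = {(\<lambda>h. g ** h) ` H | g. g \<in> G}"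

end

theory Submission
  imports Defs
begin

text \<open>
  Every \<open>g \<in> O(L)\<close> maps \<open>v\<close> and \<open>w\<close> to lattice vectors \<open>u = g v\<close>, \<open>t = g w\<close> with
  \<open>(u, u) = -2d\<close>, \<open>(u, L) \<subseteq> 2d\<int>\<close> and \<open>(t, t) = -6\<close>, \<open>(t, L) \<subseteq> 6\<int>\<close>. If \<open>g, h \<in> O(L)\<close> lie in
  the same coset of the spinor kernel and satisfy \<open>h v \<equiv> g v (mod 2d L)\<close> and
  \<open>det(h) h w \<equiv> det(g) g w (mod 6 L)\<close>, then \<open>g\<^sup>-\<^sup>1 h \<in> \<Gamma>\<close>. Spinor classes are compared by writing
  real isometries as products of reflections (Cartan-Dieudonne).

  The residues are read off the norm equations. Modulo \<open>12d\<close> the first one gives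
  \<open>d \<alpha>\<^sup>2 + 3 (u\<^sub>0\<^sup>2 - 1) \<equiv> 0\<close> with \<open>3 u\<^sub>5 = d \<alpha>\<close>. Thus \<open>d\<close> divides \<open>3 (u\<^sub>0\<^sup>2 - 1)\<close>, so each prime power
  part of \<open>d\<close> divides \<open>6 (u\<^sub>0 - 1)\<close> or \<open>6 (u\<^sub>0 + 1)\<close>: this fixes \<open>6 u\<^sub>0\<close> modulo \<open>d\<close> in
  \<open>2^\<nu>(d)\<close> ways and \<open>u\<^sub>0\<close> modulo \<open>2d\<close> in \<open>12 \<cdot> 2^\<nu>(d)\<close> ways. Then \<open>\<alpha>\<^sup>2\<close> is fixed modulo 12, and a residue
  modulo 6 is determined by its square modulo 12 and by lying in \<open>{0,1,2}\<close> or \<open>{3,4,5}\<close>; so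
  \<open>u\<^sub>5\<close> modulo \<open>2d\<close> has two possibilities. Likewise \<open>3 t\<^sub>5\<^sup>2 + d t\<^sub>0\<^sup>2 \<equiv> 3\<close> modulo 36 leaves
  \<open>6 \<cdot> 2\<close> possibilities for \<open>det(g) t\<close> modulo \<open>6 L\<close>. Altogether there are at most
  \<open>2 \<cdot> 24 \<cdot> 2^\<nu>(d) \<cdot> 12 = 576 \<cdot> 2^\<nu>(d)\<close> cosets.
\<close>

section \<open>Reflections and the spinor kernel\<close>

locale real_quadratic_space =
  fixes B :: "'a::real_vector \<Rightarrow> 'a \<Rightarrow> real"
  assumes bilinear: "bilinear B"
    and symmetric: "B x y = B y x"
begin

lemmas bilinear_simps =
  bilinear_ladd[OF bilinear] bilinear_radd[OF bilinear]
  bilinear_lsub[OF bilinear] bilinear_rsub[OF bilinear]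
  bilinear_lmul[OF bilinear] bilinear_rmul[OF bilinear]
  bilinear_lneg[OF bilinear] bilinear_rneg[OF bilinear]

definition reflection :: "'a \<Rightarrow> 'a \<Rightarrow> 'a" where
  "reflection r x = x - (2 * B x r / B r r) *\<^sub>R r"

definition isometry :: "('a \<Rightarrow> 'a) \<Rightarrow> bool" where
  "isometry f \<longleftrightarrow> linear f \<and> (\<forall>x y. B (f x) (f y) = B x y)"

lemma isometry_id: "isometry id"
  by (simp add: isometry_def linear_iff)

lemma isometry_comp: "isometry f \<Longrightarrow> isometry g \<Longrightarrow> isometry (f \<circ> g)"
  by (simp add: isometry_def linear_compose)

lemma linear_reflection: "linear (reflection r)"
  unfolding linear_iff reflection_def
  by (simp add: bilinear_simps add_divide_distrib algebra_simps)

lemma isometry_reflection: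
  assumes "B r r \<noteq> 0"
  shows "isometry (reflection r)"
  unfolding isometry_def
proof (intro conjI allI linear_reflection)
  fix x y
  show "B (reflection r x) (reflection r y) = B x y"
    using assms symmetric[of r y] by (simp add: reflection_def bilinear_simps field_simps)
qed

lemma reflection_reflection: "B r r \<noteq> 0 \<Longrightarrow> reflection r (reflection r x) = x"
  by (simp add: reflection_def bilinear_simps field_simps)

lemma reflection_orthogonal: "B z r = 0 \<Longrightarrow> reflection r z = z"
  by (simp add: reflection_def)

lemma reflection_self: "B r r \<noteq> 0 \<Longrightarrow> reflection r r = - r"
  by (simp add: reflection_def algebra_simps scaleR_2)

lemma reflection_swap:
  assumes "B x x = B y y" and "B (y - x) (y - x) \<noteq> 0"
  shows "reflection (y - x) y = x"
proof -
  have "2 * B y (y - x) = B (y - x) (y - x)"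
    using assms(1) symmetric[of x y] by (simp add: bilinear_simps)
  then show ?thesis
    using assms(2) by (simp add: reflection_def)
qed

definition anisotropic :: "'a list \<Rightarrow> bool" where
  "anisotropic rs \<longleftrightarrow> (\<forall>r\<in>set rs. B r r \<noteq> 0)"

definition reflections :: "'a list \<Rightarrow> 'a \<Rightarrow> 'a" where
  "reflections rs = foldr (\<circ>) (map reflection rs) id"

lemma anisotropic_simps [simp]:
  "anisotropic []"
  "anisotropic (r # rs) \<longleftrightarrow> B r r \<noteq> 0 \<and> anisotropic rs"
  "anisotropic (rs @ ss) \<longleftrightarrow> anisotropic rs \<and> anisotropic ss"
  "anisotropic (rev rs) \<longleftrightarrow> anisotropic rs"
  by (auto simp: anisotropic_def)

lemma reflections_simps [simp]:
  "reflections [] = id"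
  "reflections (r # rs) = reflection r \<circ> reflections rs"
  by (simp_all add: reflections_def)

lemma reflections_append: "reflections (rs @ ss) = reflections rs \<circ> reflections ss"
  by (induction rs) auto

lemma isometry_reflections: "anisotropic rs \<Longrightarrow> isometry (reflections rs)"
  by (induction rs) (simp_all add: isometry_id isometry_comp isometry_reflection)

lemma reflections_rev_cancel: "anisotropic rs \<Longrightarrow> reflections (rev rs) (reflections rs x) = x"
  by (induction rs arbitrary: x) (simp_all add: reflections_append reflection_reflection)

text \<open>The inductive step of Cartan-Dieudonne: with \<open>y = f x\<close>, the reflection in \<open>y - x\<close>
  maps \<open>y\<close> to \<open>x\<close>; if \<open>y - x\<close> is isotropic then \<open>y + x\<close> is not, and the reflections in
  \<open>y + x\<close> and \<open>x\<close> do it.\<close>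

lemma exists_reflections_undo:
  assumes f: "isometry f" and x: "B x x \<noteq> 0"
    and S: "\<And>s. s \<in> S \<Longrightarrow> f s = s \<and> B s x = 0"
  shows "\<exists>rs. anisotropic rs \<and> (\<forall>s\<in>insert x S. reflections rs (f s) = s)"
proof -
  define y where "y = f x"
  have "B y y = B x x"
    using f by (simp add: isometry_def y_def)
  have S_y: "B s y = 0" if "s \<in> S" for s
    using f S[OF that] by (metis isometry_def y_def)
  show ?thesis
  proof (cases "B (y - x) (y - x) = 0")
    case False
    have "reflection (y - x) s = s" if "s \<in> S" for s
      using S[OF that] S_y[OF that] by (intro reflection_orthogonal) (simp add: bilinear_simps)
    then show ?thesis
      using False S \<open>B y y = B x x\<close>
      by (intro exI[of _ "[y - x]"]) (auto simp: y_def[symmetric] reflection_swap)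
  next
    case True
    have "B (y + x) (y + x) = 4 * B x x - B (y - x) (y - x)"
      using \<open>B y y = B x x\<close> symmetric[of x y] by (simp add: bilinear_simps)
    then have yx: "B (y + x) (y + x) \<noteq> 0"
      using True x by simp
    have "reflection (y + x) y = - x"
      using reflection_swap[of "- x" y] yx \<open>B y y = B x x\<close> by (simp add: bilinear_simps)
    moreover have "reflection x (- x) = x"
      using x linear_reflection[of x] reflection_self[OF x] by (simp add: linear_neg)
    moreover have "reflection x (reflection (y + x) s) = s" if "s \<in> S" for s
      using S[OF that] S_y[OF that]
      by (simp add: reflection_orthogonal bilinear_simps)
    ultimately show ?thesis
      using S x yx by (intro exI[of _ "[x, y + x]"]) (auto simp: y_def[symmetric])
  qed
qed

lemma exists_reflections_undo_orthogonal:
  assumes f: "isometry f"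
    and "\<And>b. b \<in> set bs \<Longrightarrow> B b b \<noteq> 0" and "sorted_wrt (\<lambda>a b. B a b = 0) bs"
  shows "\<exists>rs. anisotropic rs \<and> (\<forall>b\<in>set bs. reflections rs (f b) = b)"
  using assms(2,3)
proof (induction bs)
  case Nil
  show ?case by (intro exI[of _ "[]"]) simp
next
  case (Cons b bs)
  then obtain rs where rs: "anisotropic rs" "\<forall>s\<in>set bs. reflections rs (f s) = s"
    by auto
  have "isometry (reflections rs \<circ> f)"
    using isometry_reflections[OF rs(1)] f by (rule isometry_comp)
  moreover have "\<And>s. s \<in> set bs \<Longrightarrow> (reflections rs \<circ> f) s = s \<and> B s b = 0"
    using rs(2) Cons.prems(2) symmetric[of _ b] by auto
  ultimately obtain ss where "anisotropic ss"
      "\<forall>s\<in>insert b (set bs). reflections ss ((reflections rs \<circ> f) s) = s"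
    using exists_reflections_undo Cons.prems(1) by (metis list.set_intros(1))
  then show ?case
    using rs by (intro exI[of _ "ss @ rs"]) (auto simp: reflections_append)
qed

definition spinor_even :: "'a list \<Rightarrow> bool" where
  "spinor_even rs \<longleftrightarrow> even (length (filter (\<lambda>r. B r r > 0) rs))"

definition kernel_spinor_norm :: "('a \<Rightarrow> 'a) set" where
  "kernel_spinor_norm = {f. \<exists>rs. anisotropic rs \<and> f = reflections rs \<and> spinor_even rs}"

lemma spinor_even_append: "spinor_even (rs @ ss) \<longleftrightarrow> (spinor_even rs \<longleftrightarrow> spinor_even ss)"
  by (simp add: spinor_even_def)

lemma spinor_even_rev: "spinor_even (rev rs) \<longleftrightarrow> spinor_even rs"
  by (simp add: spinor_even_def rev_filter[symmetric])

lemma kernel_spinor_norm_comp: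
  assumes "f \<in> kernel_spinor_norm" and "g \<in> kernel_spinor_norm"
  shows "f \<circ> g \<in> kernel_spinor_norm"
proof -
  obtain rs ss where "anisotropic rs" "f = reflections rs" "spinor_even rs"
    "anisotropic ss" "g = reflections ss" "spinor_even ss"
    using assms by (auto simp: kernel_spinor_norm_def)
  then show ?thesis
    unfolding kernel_spinor_norm_def
    by (intro CollectI exI[of _ "rs @ ss"]) (simp add: reflections_append spinor_even_append)
qed

end

locale real_quadratic_space_orthogonal_basis = real_quadratic_space +
  fixes basis :: "'a list"
  assumes basis_anisotropic: "b \<in> set basis \<Longrightarrow> B b b \<noteq> 0"
    and basis_orthogonal: "sorted_wrt (\<lambda>a b. B a b = 0) basis"
    and basis_span: "span (set basis) = UNIV"
begin

theorem isometry_eq_reflections: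
  assumes f: "isometry f"
  obtains rs where "anisotropic rs" and "f = reflections rs"
proof -
  obtain rs where rs: "anisotropic rs" "\<forall>b\<in>set basis. reflections rs (f b) = b"
    using exists_reflections_undo_orthogonal[OF f basis_anisotropic basis_orthogonal] by blast
  have "linear (reflections rs \<circ> f)"
    using isometry_comp[OF isometry_reflections[OF rs(1)] f] by (simp add: isometry_def)
  then have id: "reflections rs (f x) = x" for x
    using linear_eq_on_span[of "reflections rs \<circ> f" id "set basis" x] rs(2) basis_span
    by (simp add: linear_id)
  have "f x = reflections (rev rs) x" for x
    using reflections_rev_cancel[OF rs(1), of "f x"] id by simp
  then show ?thesis
    using that[of "rev rs"] rs(1) by auto
qed

lemma isometry_eq_reflections_spinor_even:
  assumes "isometry f"
  obtains rs where "anisotropic rs" and "f = reflections rs"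
    and "spinor_even rs \<longleftrightarrow> f \<in> kernel_spinor_norm"
proof (cases "f \<in> kernel_spinor_norm")
  case True
  then show ?thesis
    using that by (auto simp: kernel_spinor_norm_def)
next
  case False
  obtain rs where "anisotropic rs" "f = reflections rs"
    using isometry_eq_reflections[OF assms] .
  then show ?thesis
    using that[of rs] False by (auto simp: kernel_spinor_norm_def)
qed

lemma left_inverse_comp_kernel_spinor_norm:
  assumes f: "isometry f" and g: "isometry g" and f': "\<And>x. f' (f x) = x"
    and same: "f \<in> kernel_spinor_norm \<longleftrightarrow> g \<in> kernel_spinor_norm"
  shows "f' \<circ> g \<in> kernel_spinor_norm"
proof -
  obtain rs where rs: "anisotropic rs" "f = reflections rs"
      "spinor_even rs \<longleftrightarrow> f \<in> kernel_spinor_norm"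
    using isometry_eq_reflections_spinor_even[OF f] .
  obtain ss where ss: "anisotropic ss" "g = reflections ss"
      "spinor_even ss \<longleftrightarrow> g \<in> kernel_spinor_norm"
    using isometry_eq_reflections_spinor_even[OF g] .
  have "f' x = reflections (rev rs) x" for x
    using f'[of "reflections (rev rs) x"] reflections_rev_cancel[of "rev rs" x] rs(1,2) by simp
  then have "f' \<circ> g = reflections (rev rs @ ss)"
    using ss(2) by (auto simp: reflections_append)
  then show ?thesis
    using rs ss same unfolding kernel_spinor_norm_def
    by (intro CollectI exI[of _ "rev rs @ ss"]) (simp add: spinor_even_append spinor_even_rev)
qed

end

section \<open>Congruences\<close>

lemma sq_mod_12_imp_mod_6:
  fixes a b :: int
  assumes "12 dvd a\<^sup>2 - b\<^sup>2" and "a mod 6 < 3 \<longleftrightarrow> b mod 6 < 3"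
  shows "a mod 6 = b mod 6"
proof -
  have sq: "12 dvd x\<^sup>2 - (x mod 6)\<^sup>2" for x :: int
  proof -
    have "(6 * q + r)\<^sup>2 - r\<^sup>2 = 12 * (q * (3 * q + r))" for q r :: int
      by (simp add: power2_eq_square algebra_simps)
    then have "x\<^sup>2 - (x mod 6)\<^sup>2 = 12 * (x div 6 * (3 * (x div 6) + x mod 6))"
      by (metis mult_div_mod_eq)
    then show ?thesis by simp
  qed
  define r s where "r = a mod 6" and "s = b mod 6"
  have "12 dvd (a\<^sup>2 - b\<^sup>2) - (a\<^sup>2 - r\<^sup>2) + (b\<^sup>2 - s\<^sup>2)"
    using assms(1) sq[of a] sq[of b] unfolding r_def s_def by (rule dvd_add[OF dvd_diff])
  then have "12 dvd r\<^sup>2 - s\<^sup>2"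
    by simp
  moreover have "r = 0 \<or> r = 1 \<or> r = 2 \<or> r = 3 \<or> r = 4 \<or> r = 5"
    "s = 0 \<or> s = 1 \<or> s = 2 \<or> s = 3 \<or> s = 4 \<or> s = 5"
    unfolding r_def s_def by presburger+
  moreover have "r < 3 \<longleftrightarrow> s < 3"
    using assms(2) by (simp add: r_def s_def)
  ultimately have "r = s"
    by (elim disjE) simp_all
  then show ?thesis by (simp add: r_def s_def)
qed

lemma mod_block_eq_imp_dvd:
  fixes m k x y :: int
  assumes "0 < m" and "m dvd x - y" and "x mod (k * m) div m = y mod (k * m) div m"
  shows "k * m dvd x - y"
proof -
  define X Y where "X = x mod (k * m)" and "Y = y mod (k * m)"
  have "X mod m = Y mod m"
    using assms(2) by (simp add: X_def Y_def mod_mod_cancel mod_eq_dvd_iff)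
  moreover have "X div m = Y div m"
    using assms(3) by (simp add: X_def Y_def)
  ultimately have "X = Y"
    by (metis div_mult_mod_eq)
  then show ?thesis
    by (simp add: X_def Y_def mod_eq_dvd_iff)
qed

lemma mod_block_range:
  fixes m k x :: int
  assumes "0 < m" and "0 < k"
  shows "x mod (k * m) div m \<in> {0..<k}"
proof -
  define X where "X = x mod (k * m)"
  have X: "0 \<le> X" "X < k * m"
    using assms by (simp_all add: X_def)
  have "X div m < k"
  proof (rule ccontr)
    assume "\<not> X div m < k"
    then have "k * m \<le> X div m * m"
      using assms by (simp add: mult_right_mono)
    also have "\<dots> \<le> X"
      using assms minus_mod_eq_div_mult[of X m] pos_mod_sign[of m X] by linarith
    finally show False
      using X by simp
  qed
  then show ?thesis
    using X assms by (simp add: X_def pos_imp_zdiv_nonneg_iff)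
qed

lemma two_power_dvd_3_sq_minus_1:
  fixes x :: int
  assumes "odd x" and "2 ^ k dvd 3 * (x\<^sup>2 - 1)"
  shows "2 ^ k dvd 6 * (x - 1) \<or> 2 ^ k dvd 6 * (x + 1)"
proof -
  obtain a where a: "x = 2 * a + 1"
    using assms(1) oddE by blast
  have "2 ^ k dvd 3 * (4 * a * (a + 1))"
    using assms(2) by (simp add: a power2_eq_square algebra_simps)
  then have "2 ^ k dvd 4 * a * (a + 1)"
    by (subst (asm) coprime_dvd_mult_right_iff) simp_all
  then have "2 ^ k dvd a * (4 * (a + 1))" "2 ^ k dvd (a + 1) * (4 * a)"
    by (simp_all add: ac_simps)
  moreover have "coprime ((2::int) ^ k) a \<or> coprime ((2::int) ^ k) (a + 1)"
    by (cases "even a") simp_all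
  ultimately have "2 ^ k dvd 4 * a \<or> 2 ^ k dvd 4 * (a + 1)"
    using coprime_dvd_mult_right_iff by blast
  then have "2 ^ k dvd 3 * (4 * a) \<or> 2 ^ k dvd 3 * (4 * (a + 1))"
    using dvd_mult by blast
  then show ?thesis
    by (simp add: a algebra_simps)
qed

lemma prime_power_dvd_3_sq_minus_1:
  fixes x :: int
  assumes p: "prime p" and dvd: "p ^ k dvd 3 * (x\<^sup>2 - 1)"
  shows "p ^ k dvd 6 * (x - 1) \<or> p ^ k dvd 6 * (x + 1)"
proof -
  have split: "3 * (x\<^sup>2 - 1) = (x - 1) * (3 * (x + 1))" "3 * (x\<^sup>2 - 1) = (x + 1) * (3 * (x - 1))"
    by (simp_all add: power2_eq_square algebra_simps)
  consider "\<not> p dvd x - 1" | "\<not> p dvd x + 1" | "p dvd x - 1" "p dvd x + 1"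
    by blast
  then show ?thesis
  proof cases
    case 1
    then have "p ^ k dvd 3 * (x + 1)"
      using p dvd split(1) by (metis coprime_dvd_mult_right_iff coprime_power_left_iff prime_imp_coprime)
    then have "p ^ k dvd 2 * (3 * (x + 1))"
      by (rule dvd_mult)
    then show ?thesis
      by simp
  next
    case 2
    then have "p ^ k dvd 3 * (x - 1)"
      using p dvd split(2) by (metis coprime_dvd_mult_right_iff coprime_power_left_iff prime_imp_coprime)
    then have "p ^ k dvd 2 * (3 * (x - 1))"
      by (rule dvd_mult)
    then show ?thesis
      by simp
  next
    case 3
    then have "p dvd 2"
      using dvd_diff[of p "x + 1" "x - 1"] by simp
    then have "p = 2"
      using primes_dvd_imp_eq[OF p _ \<open>p dvd 2\<close>] by simp
    moreover have "odd x"
      using 3 \<open>p = 2\<close> by simp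
    ultimately show ?thesis
      using two_power_dvd_3_sq_minus_1 dvd by blast
  qed
qed

lemma dvd_if_prime_powers_dvd:
  fixes n :: nat and z :: int
  assumes "0 < n" and "\<And>p. p \<in> prime_factors n \<Longrightarrow> int p ^ multiplicity p n dvd z"
  shows "int n dvd z"
proof (cases "z = 0")
  case False
  have "n dvd nat \<bar>z\<bar>"
  proof (rule multiplicity_le_imp_dvd)
    fix p :: nat
    assume p: "prime p"
    show "multiplicity p n \<le> multiplicity p (nat \<bar>z\<bar>)"
    proof (cases "p \<in> prime_factors n")
      case True
      then have "p ^ multiplicity p n dvd nat \<bar>z\<bar>"
        using assms(2) by (metis dvd_nat_abs_iff of_nat_power)
      then show ?thesis
        using False p by (intro multiplicity_geI) auto
    next
      case False
      then show ?thesis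
        using p by (auto simp: prime_factors_multiplicity)
    qed
  qed (use assms(1) in simp)
  then show ?thesis
    by simp
qed simp

text \<open>For \<open>n dvd 3 (x\<^sup>2 - 1)\<close>, each prime power part of \<open>n\<close> divides \<open>6 (x - 1)\<close> or \<open>6 (x + 1)\<close>;
  the set of primes for which the first alternative holds pins down \<open>6 x\<close> modulo \<open>n\<close>.\<close>

definition root_signature :: "nat \<Rightarrow> int \<Rightarrow> nat set" where
  "root_signature n x = {p \<in> prime_factors n. int p ^ multiplicity p n dvd 6 * (x - 1)}"

lemma root_signature_subset: "root_signature n x \<subseteq> prime_factors n"
  by (auto simp: root_signature_def)

lemma root_signature_eq_imp_dvd:
  fixes n :: nat and x y :: int
  assumes "0 < n" and "int n dvd 3 * (x\<^sup>2 - 1)" and "int n dvd 3 * (y\<^sup>2 - 1)"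
    and "root_signature n x = root_signature n y"
  shows "int n dvd 6 * (x - y)"
proof (rule dvd_if_prime_powers_dvd[OF assms(1)])
  fix p
  assume pf: "p \<in> prime_factors n"
  define P where "P = int p ^ multiplicity p n"
  have "P dvd int n"
    by (metis P_def multiplicity_dvd of_nat_dvd_iff of_nat_power)
  then have "P dvd 6 * (x - 1) \<or> P dvd 6 * (x + 1)" "P dvd 6 * (y - 1) \<or> P dvd 6 * (y + 1)"
    using pf assms(2,3) prime_power_dvd_3_sq_minus_1[of "int p"] unfolding P_def
    by (auto intro: dvd_trans)
  moreover have "P dvd 6 * (x - 1) \<longleftrightarrow> P dvd 6 * (y - 1)"
    using assms(4) pf by (auto simp: root_signature_def P_def set_eq_iff)
  moreover have "6 * (x - y) = 6 * (x - 1) - 6 * (y - 1)" "6 * (x - y) = 6 * (x + 1) - 6 * (y + 1)"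
    by (simp_all add: algebra_simps)
  ultimately show "int p ^ multiplicity p n dvd 6 * (x - y)"
    unfolding P_def[symmetric] by (metis dvd_diff)
qed

section \<open>The lattice \<open>L\<close>\<close>

lemma exhaust_6:
  fixes i :: 6
  obtains "i = 0" | "i = 1" | "i = 2" | "i = 3" | "i = 4" | "i = 5"
proof (induct i)
  case (of_int z)
  then have "z = 0 \<or> z = 1 \<or> z = 2 \<or> z = 3 \<or> z = 4 \<or> z = 5"
    by fastforce
  then show ?case
    using of_int.prems by auto
qed

lemma forall_6: "(\<forall>i::6. P i) \<longleftrightarrow> P 0 \<and> P 1 \<and> P 2 \<and> P 3 \<and> P 4 \<and> P 5"
  by (metis exhaust_6)

lemma sum_6: "sum f (UNIV :: 6 set) = f 0 + f 1 + f 2 + f 3 + f 4 + f 5"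
proof -
  have "i \<in> {0, 1, 2, 3, 4, 5}" for i :: 6
    by (cases i rule: exhaust_6) simp_all
  then have U: "UNIV = {0, 1, 2, 3, 4, 5 :: 6}"
    by blast
  show ?thesis
    unfolding U by (simp add: ac_simps)
qed

lemma axis_nth_6: "axis (i::6) (1::real) $ j = (if j = i then 1 else 0)"
  by (simp add: axis_def)

lemma bilL_coords:
  "bilL d x y = x$1 * y$2 + x$2 * y$1 + x$3 * y$4 + x$4 * y$3 - 6 * x$5 * y$5
     - 2 * real d * x$0 * y$0"
  unfolding bilL_def gramL_def inner_vec_def matrix_vector_mult_def
  by (simp add: sum_6 algebra_simps)

lemma bilinear_bilL: "bilinear (bilL d)"
  unfolding bilinear_def linear_iff by (simp add: bilL_coords algebra_simps)

interpretation L: real_quadratic_space "bilL d" for d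
  by unfold_locales (simp_all add: bilinear_bilL bilL_coords algebra_simps)

lemma spinor_kernel_eq: "spinor_kernel d = {g. (*v) g \<in> L.kernel_spinor_norm d}"
proof -
  have "reflL d = L.reflection d"
    by (intro ext) (simp add: reflL_def L.reflection_def)
  then show ?thesis
    by (simp add: spinor_kernel_def L.kernel_spinor_norm_def L.reflections_def
        L.anisotropic_def L.spinor_even_def)
qed

definition lattice_basis :: "(real^6) list" where
  "lattice_basis = [axis 1 1 + axis 2 1, axis 1 1 - axis 2 1, axis 3 1 + axis 4 1,
     axis 3 1 - axis 4 1, axis 5 1, axis 0 1]"

lemma span_lattice_basis: "span (set lattice_basis) = UNIV"
proof -
  have "x \<in> span (set lattice_basis)" for x :: "real^6"
  proof -
    have "x = ((x$1 + x$2) / 2) *\<^sub>R (axis 1 1 + axis 2 1) + ((x$1 - x$2) / 2) *\<^sub>R (axis 1 1 - axis 2 1)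
        + ((x$3 + x$4) / 2) *\<^sub>R (axis 3 1 + axis 4 1) + ((x$3 - x$4) / 2) *\<^sub>R (axis 3 1 - axis 4 1)
        + x$5 *\<^sub>R axis 5 1 + x$0 *\<^sub>R axis 0 1"
      by (simp add: vec_eq_iff forall_6 axis_nth_6 field_simps)
    also have "\<dots> \<in> span (set lattice_basis)"
      unfolding lattice_basis_def by (intro span_add span_scale span_base) simp_all
    finally show ?thesis .
  qed
  then show ?thesis
    by auto
qed

lemma lattice_orthogonal_basis:
  assumes "0 < d"
  shows "real_quadratic_space_orthogonal_basis (bilL d) lattice_basis"
proof unfold_locales
  show "bilL d b b \<noteq> 0" if "b \<in> set lattice_basis" for b
    using that assms by (auto simp: lattice_basis_def bilL_coords axis_nth_6)
  show "sorted_wrt (\<lambda>a b. bilL d a b = 0) lattice_basis"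
    by (simp add: lattice_basis_def bilL_coords axis_nth_6)
qed (fact span_lattice_basis)

lemma OL_int_mat: "g \<in> OL d \<Longrightarrow> int_mat g"
  by (simp add: OL_def)

lemma OL_bilL: "g \<in> OL d \<Longrightarrow> bilL d (g *v x) (g *v y) = bilL d x y"
  by (simp add: OL_def)

lemma OL_isometry: "g \<in> OL d \<Longrightarrow> L.isometry d ((*v) g)"
  by (simp add: L.isometry_def OL_bilL)

lemma int_mat_mult: "int_mat A \<Longrightarrow> int_mat B \<Longrightarrow> int_mat (A ** B)"
  unfolding int_mat_def matrix_matrix_mult_def by auto

lemma int_vec_add: "int_vec x \<Longrightarrow> int_vec y \<Longrightarrow> int_vec (x + y)"
  by (simp add: int_vec_def)

lemma int_vec_scale: "c \<in> \<int> \<Longrightarrow> int_vec x \<Longrightarrow> int_vec (c *\<^sub>R x)"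
  by (simp add: int_vec_def)

lemma int_vec_mat: "int_mat A \<Longrightarrow> int_vec x \<Longrightarrow> int_vec (A *v x)"
  unfolding int_vec_def int_mat_def matrix_vector_mult_def by auto

lemma int_mat_det: "int_mat A \<Longrightarrow> det A \<in> \<int>"
  unfolding int_mat_def det_def by (fastforce intro!: Ints_mult)

lemma OL_mult:
  assumes "g \<in> OL d" and "h \<in> OL d"
  shows "g ** h \<in> OL d"
proof -
  obtain g' h' where "int_mat g'" "g ** g' = mat 1" "g' ** g = mat 1"
      "int_mat h'" "h ** h' = mat 1" "h' ** h = mat 1"
    using assms by (auto simp: OL_def)
  then have "int_mat (h' ** g')" "(g ** h) ** (h' ** g') = mat 1" "(h' ** g') ** (g ** h) = mat 1"
    by (simp_all add: int_mat_mult matrix_mul_assoc)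
       (metis matrix_mul_assoc matrix_mul_rid)+
  then show ?thesis
    using assms by (auto simp: OL_def int_mat_mult matrix_vector_mul_assoc[symmetric])
qed

lemma OL_inverse:
  assumes "g \<in> OL d"
  obtains g' where "g' \<in> OL d" and "g ** g' = mat 1" and "g' ** g = mat 1"
proof -
  obtain g' where g': "int_mat g'" "g ** g' = mat 1" "g' ** g = mat 1"
    using assms by (auto simp: OL_def)
  have "bilL d (g' *v x) (g' *v y) = bilL d x y" for x y
    using OL_bilL[OF assms, of "g' *v x" "g' *v y"] g'(2) by (simp add: matrix_vector_mul_assoc)
  then have "g' \<in> OL d"
    using assms g' by (auto simp: OL_def)
  then show ?thesis
    using that g' by blast
qed

lemma OL_det:
  assumes "g \<in> OL d"
  shows "det g = of_int \<lfloor>det g\<rfloor>" and "\<lfloor>det g\<rfloor> * \<lfloor>det g\<rfloor> = 1"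
proof -
  obtain g' where g': "int_mat g'" "g ** g' = mat 1"
    using assms by (auto simp: OL_def)
  obtain a b where a: "det g = of_int a" and b: "det g' = of_int b"
    using int_mat_det[OF OL_int_mat[OF assms]] int_mat_det[OF g'(1)] by (auto elim!: Ints_cases)
  have "det g * det g' = 1"
    using g'(2) by (metis det_mul det_I)
  then have "a * b = 1"
    unfolding a b by (metis of_int_eq_1_iff of_int_mult)
  with a show "det g = of_int \<lfloor>det g\<rfloor>" and "\<lfloor>det g\<rfloor> * \<lfloor>det g\<rfloor> = 1"
    using zmult_eq_1_iff[of a b] by auto
qed

lemma OL_det_left_inverse_mult:
  assumes g: "g \<in> OL d" and h: "h \<in> OL d" and g': "g' ** g = mat 1"
  shows "det (g' ** h) = of_int (\<lfloor>det h\<rfloor> * \<lfloor>det g\<rfloor>)"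
proof -
  have "det g' = det g"
  proof -
    have "det g * det g = 1"
      using OL_det[OF g] by (metis of_int_1 of_int_mult)
    then have "det g' = (det g' * det g) * det g"
      by (simp add: mult.assoc)
    also have "det g' * det g = 1"
      using g' by (metis det_mul det_I)
    finally show ?thesis
      by simp
  qed
  then have "det (g' ** h) = det g * det h"
    by (simp add: det_mul)
  also have "\<dots> = of_int \<lfloor>det g\<rfloor> * of_int \<lfloor>det h\<rfloor>"
    using OL_det(1)[OF g] OL_det(1)[OF h] by (rule arg_cong2[where f = "(*)"])
  finally show ?thesis
    by simp
qed

lemma spinor_kernel_mult:
  assumes "a \<in> spinor_kernel d" and "b \<in> spinor_kernel d"
  shows "a ** b \<in> spinor_kernel d"
proof -
  have "(*v) (a ** b) = (*v) a \<circ> (*v) b"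
    by (simp add: fun_eq_iff matrix_vector_mul_assoc)
  then show ?thesis
    using assms L.kernel_spinor_norm_comp by (simp add: spinor_kernel_eq)
qed

lemma OL_left_inverse_mult_spinor_kernel:
  assumes "0 < d" and g: "g \<in> OL d" and h: "h \<in> OL d" and g': "g' ** g = mat 1"
    and "g \<in> spinor_kernel d \<longleftrightarrow> h \<in> spinor_kernel d"
  shows "g' ** h \<in> spinor_kernel d"
proof -
  have "(*v) (g' ** h) = (*v) g' \<circ> (*v) h"
    by (simp add: fun_eq_iff matrix_vector_mul_assoc)
  moreover have "g' *v (g *v x) = x" for x
    using g' by (simp add: matrix_vector_mul_assoc)
  ultimately show ?thesis
    using real_quadratic_space_orthogonal_basis.left_inverse_comp_kernel_spinor_norm[
        OF lattice_orthogonal_basis[OF \<open>0 < d\<close>] OL_isometry[OF g] OL_isometry[OF h]] assms(5)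
    by (simp add: spinor_kernel_eq)
qed

section \<open>The images of \<open>v\<close> and \<open>w\<close>\<close>

definition int_col :: "real^6^6 \<Rightarrow> 6 \<Rightarrow> 6 \<Rightarrow> int" where
  "int_col g j i = \<lfloor>g $ i $ j\<rfloor>"

definition unit_vec :: "6 \<Rightarrow> 6 \<Rightarrow> int" where
  "unit_vec j i = (if i = j then 1 else 0)"

definition bil_int :: "nat \<Rightarrow> (6 \<Rightarrow> int) \<Rightarrow> (6 \<Rightarrow> int) \<Rightarrow> int" where
  "bil_int d x y = x 1 * y 2 + x 2 * y 1 + x 3 * y 4 + x 4 * y 3 - 6 * x 5 * y 5
     - 2 * int d * x 0 * y 0"

lemma int_mat_mult_axis: "int_mat g \<Longrightarrow> (g *v axis j 1) $ i = of_int (int_col g j i)"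
  by (simp add: int_mat_def int_col_def matrix_vector_mult_def axis_def if_distrib cong: if_cong)

lemma int_col_mat_1: "int_col (mat 1) j = unit_vec j"
  by (simp add: fun_eq_iff int_col_def unit_vec_def mat_def)

lemma bilL_int_col:
  "int_mat g \<Longrightarrow> int_mat h \<Longrightarrow>
     bilL d (g *v axis j 1) (h *v axis k 1) = of_int (bil_int d (int_col g j) (int_col h k))"
  by (simp add: bilL_coords bil_int_def int_mat_mult_axis)

lemma int_mat_1: "int_mat (mat 1)"
  by (simp add: int_mat_def mat_def)

lemma OL_int_col_norm:
  assumes "g \<in> OL d"
  shows "bil_int d (int_col g j) (int_col g j) = bil_int d (unit_vec j) (unit_vec j)"
proof -
  have "bilL d (g *v axis j 1) (g *v axis j 1) = bilL d (mat 1 *v axis j 1) (mat 1 *v axis j 1)"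
    using OL_bilL[OF assms] by simp
  then show ?thesis
    using OL_int_mat[OF assms] int_mat_1 by (simp only: bilL_int_col int_col_mat_1 of_int_eq_iff)
qed

lemma OL_int_col_adjoint:
  assumes "g \<in> OL d" and "g ** g' = mat 1" and "int_mat g'"
  shows "bil_int d (int_col g j) (unit_vec k) = bil_int d (unit_vec j) (int_col g' k)"
proof -
  have "g *v (g' *v axis k 1) = mat 1 *v axis k 1"
    using assms(2) by (simp add: matrix_vector_mul_assoc)
  then have "bilL d (g *v axis j 1) (mat 1 *v axis k 1) = bilL d (mat 1 *v axis j 1) (g' *v axis k 1)"
    using OL_bilL[OF assms(1), of "axis j 1" "g' *v axis k 1"] by simp
  then show ?thesis
    using OL_int_mat[OF assms(1)] int_mat_1 assms(3)
    by (simp only: bilL_int_col int_col_mat_1 of_int_eq_iff)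
qed

lemma bil_int_unit_vec [simp]:
  "bil_int d x (unit_vec 0) = - 2 * int d * x 0"
  "bil_int d x (unit_vec 1) = x 2"
  "bil_int d x (unit_vec 2) = x 1"
  "bil_int d x (unit_vec 3) = x 4"
  "bil_int d x (unit_vec 4) = x 3"
  "bil_int d x (unit_vec 5) = - 6 * x 5"
  by (simp_all add: bil_int_def unit_vec_def)

lemma bil_int_expand_right:
  "bil_int d x y = y 0 * bil_int d x (unit_vec 0) + y 1 * bil_int d x (unit_vec 1)
     + y 2 * bil_int d x (unit_vec 2) + y 3 * bil_int d x (unit_vec 3)
     + y 4 * bil_int d x (unit_vec 4) + y 5 * bil_int d x (unit_vec 5)"
  unfolding bil_int_unit_vec by (simp add: bil_int_def algebra_simps)

text \<open>\<open>div_vector d n u\<close> says that \<open>u / n\<close> lies in the dual lattice and has square \<open>-1/n\<close>.\<close>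

definition div_vector :: "nat \<Rightarrow> int \<Rightarrow> (6 \<Rightarrow> int) \<Rightarrow> bool" where
  "div_vector d n u \<longleftrightarrow> bil_int d u u = - n \<and> (\<forall>k. n dvd bil_int d u (unit_vec k))"

lemma div_vector_dvd_bil_int: "div_vector d n u \<Longrightarrow> n dvd bil_int d u y"
  unfolding div_vector_def by (subst bil_int_expand_right) (simp del: bil_int_unit_vec)

lemma div_vector_unit_vec_0: "div_vector d (2 * int d) (unit_vec 0)"
  by (simp add: div_vector_def forall_6) (simp add: unit_vec_def bil_int_def)

lemma div_vector_unit_vec_5: "div_vector d 6 (unit_vec 5)"
  by (simp add: div_vector_def forall_6) (simp add: unit_vec_def bil_int_def)

lemma div_vector_sign:
  assumes "s * s = 1" and "div_vector d n u"
  shows "div_vector d n (\<lambda>i. s * u i)"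
proof -
  have "bil_int d (\<lambda>i. s * u i) y = s * bil_int d u y" for y
    by (simp add: bil_int_def algebra_simps)
  moreover have "bil_int d (\<lambda>i. s * u i) (\<lambda>i. s * u i) = (s * s) * bil_int d u u"
    by (simp add: bil_int_def algebra_simps)
  ultimately show ?thesis
    using assms by (simp add: div_vector_def del: bil_int_unit_vec)
qed

lemma OL_int_col_div_vector:
  assumes "g \<in> OL d" and "div_vector d n (unit_vec j)"
  shows "div_vector d n (int_col g j)"
proof -
  obtain g' where "g' \<in> OL d" "g ** g' = mat 1"
    using OL_inverse[OF assms(1)] by blast
  then have "bil_int d (int_col g j) (unit_vec k) = bil_int d (unit_vec j) (int_col g' k)" for k
    using OL_int_col_adjoint[OF assms(1)] OL_int_mat by blast
  then show ?thesis
    using assms OL_int_col_norm[OF assms(1)] div_vector_dvd_bil_int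
    by (simp add: div_vector_def del: bil_int_unit_vec)
qed

lemma div_vector_coords:
  assumes "div_vector d n u"
  shows "n dvd u 1" "n dvd u 2" "n dvd u 3" "n dvd u 4" "n dvd 6 * u 5" "n dvd 2 * int d * u 0"
    and "2 * u 1 * u 2 + 2 * u 3 * u 4 - 6 * (u 5)\<^sup>2 - 2 * int d * (u 0)\<^sup>2 = - n"
proof -
  have "n dvd bil_int d u (unit_vec k)" for k
    using assms by (simp add: div_vector_def del: bil_int_unit_vec)
  from this[of 2] this[of 1] this[of 4] this[of 3] this[of 5] this[of 0]
  show "n dvd u 1" "n dvd u 2" "n dvd u 3" "n dvd u 4" "n dvd 6 * u 5" "n dvd 2 * int d * u 0"
    by simp_all
  show "2 * u 1 * u 2 + 2 * u 3 * u 4 - 6 * (u 5)\<^sup>2 - 2 * int d * (u 0)\<^sup>2 = - n"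
    using assms by (simp add: div_vector_def bil_int_def power2_eq_square algebra_simps)
qed

lemma div_vector_2d_residue:
  assumes "0 < d" and u: "div_vector d (2 * int d) u"
  shows "3 * u 5 = int d * (3 * u 5 div int d)"
    and "12 * int d dvd int d * (3 * u 5 div int d)\<^sup>2 + 3 * ((u 0)\<^sup>2 - 1)"
proof -
  note coords = div_vector_coords[OF u]
  obtain k where "6 * u 5 = 2 * int d * k"
    using coords(5) by (elim dvdE)
  then have "3 * u 5 = int d * k"
    by linarith
  then have "int d dvd 3 * u 5"
    by simp
  then show \<alpha>: "3 * u 5 = int d * (3 * u 5 div int d)"
    by simp
  define \<alpha> where "\<alpha> = 3 * u 5 div int d"
  obtain a1 a2 a3 a4 where a: "u 1 = 2 * int d * a1" "u 2 = 2 * int d * a2"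
      "u 3 = 2 * int d * a3" "u 4 = 2 * int d * a4"
    using coords(1-4) unfolding dvd_def by blast
  have "2 * int d * (u 5 * \<alpha> + (u 0)\<^sup>2 - 1 - 4 * int d * (a1 * a2 + a3 * a4)) = 0"
    using coords(7) \<alpha> unfolding a \<alpha>_def[symmetric] by (simp add: algebra_simps power2_eq_square)
  then have E: "u 5 * \<alpha> + (u 0)\<^sup>2 - 1 = 4 * int d * (a1 * a2 + a3 * a4)"
    using assms(1) by simp
  have "int d * \<alpha>\<^sup>2 = 3 * (u 5 * \<alpha>)"
    using \<alpha> unfolding \<alpha>_def[symmetric] by (simp add: power2_eq_square)
  then have "int d * \<alpha>\<^sup>2 + 3 * ((u 0)\<^sup>2 - 1) = 3 * (u 5 * \<alpha> + (u 0)\<^sup>2 - 1)"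
    by simp
  also have "\<dots> = 12 * int d * (a1 * a2 + a3 * a4)"
    unfolding E by simp
  finally show "12 * int d dvd int d * (3 * u 5 div int d)\<^sup>2 + 3 * ((u 0)\<^sup>2 - 1)"
    unfolding \<alpha>_def by simp
qed

lemma div_vector_2d_root:
  assumes "0 < d" and "div_vector d (2 * int d) u"
  shows "int d dvd 3 * ((u 0)\<^sup>2 - 1)"
proof -
  have "int d dvd int d * (3 * u 5 div int d)\<^sup>2 + 3 * ((u 0)\<^sup>2 - 1)"
    using div_vector_2d_residue(2)[OF assms] by (rule dvd_mult_right)
  then show ?thesis
    by (simp add: dvd_add_right_iff)
qed

lemma div_vector_2d_sq_congruent:
  assumes "0 < d" and u: "div_vector d (2 * int d) u" and u': "div_vector d (2 * int d) u'"
    and u0: "2 * int d dvd u 0 - u' 0"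
  shows "12 dvd (3 * u 5 div int d)\<^sup>2 - (3 * u' 5 div int d)\<^sup>2"
proof -
  define \<alpha> \<alpha>' where "\<alpha> = 3 * u 5 div int d" and "\<alpha>' = 3 * u' 5 div int d"
  note R = div_vector_2d_residue(2)[OF assms(1) u, folded \<alpha>_def]
  note R' = div_vector_2d_residue(2)[OF assms(1) u', folded \<alpha>'_def]
  obtain k where "u 0 - u' 0 = 2 * int d * k"
    using u0 by (elim dvdE)
  then have k: "u 0 = u' 0 + 2 * int d * k"
    by simp
  have "3 * ((u 0)\<^sup>2 - 1) - 3 * ((u' 0)\<^sup>2 - 1) = 12 * int d * (k * (u' 0 + int d * k))"
    unfolding k by (simp add: power2_eq_square algebra_simps)
  then have "int d * (\<alpha>\<^sup>2 - \<alpha>'\<^sup>2) = (int d * \<alpha>\<^sup>2 + 3 * ((u 0)\<^sup>2 - 1))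
      - (int d * \<alpha>'\<^sup>2 + 3 * ((u' 0)\<^sup>2 - 1)) - 12 * int d * (k * (u' 0 + int d * k))"
    by (simp add: algebra_simps)
  also have "12 * int d dvd \<dots>"
    by (rule dvd_diff[OF dvd_diff[OF R R'] dvd_triv_left])
  finally have "12 * int d dvd int d * (\<alpha>\<^sup>2 - \<alpha>'\<^sup>2)" .
  then show ?thesis
    using assms(1) by (simp add: \<alpha>_def \<alpha>'_def mult.commute[of 12])
qed

lemma div_vector_2d_congruent:
  assumes "0 < d" and u: "div_vector d (2 * int d) u" and u': "div_vector d (2 * int d) u'"
    and u0: "2 * int d dvd u 0 - u' 0"
    and half: "(3 * u 5 div int d) mod 6 < 3 \<longleftrightarrow> (3 * u' 5 div int d) mod 6 < 3"
  shows "2 * int d dvd u i - u' i"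
proof -
  have "6 dvd 3 * u 5 div int d - 3 * u' 5 div int d"
    using sq_mod_12_imp_mod_6[OF div_vector_2d_sq_congruent[OF assms(1-4)] half]
    by (simp add: mod_eq_dvd_iff)
  then obtain j where "3 * u 5 div int d - 3 * u' 5 div int d = 6 * j"
    by (elim dvdE)
  then have "3 * (u 5 - u' 5) = 3 * (2 * int d * j)"
    using div_vector_2d_residue(1)[OF assms(1) u] div_vector_2d_residue(1)[OF assms(1) u']
    by (simp add: algebra_simps)
  then have "u 5 - u' 5 = 2 * int d * j"
    by (simp only: mult_cancel_left) simp
  then have u5: "2 * int d dvd u 5 - u' 5"
    by simp
  note c = div_vector_coords[OF u] and c' = div_vector_coords[OF u']
  show ?thesis
    by (cases i rule: exhaust_6) (simp_all only: u0 u5 dvd_diff c(1-4) c'(1-4))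
qed

lemma div_vector_6_residue:
  assumes "div_vector d 6 t"
  shows "36 dvd 3 * (t 5)\<^sup>2 + int d * (t 0)\<^sup>2 - 3" and "3 dvd int d * t 0"
proof -
  note coords = div_vector_coords[OF assms]
  obtain a1 a2 a3 a4 where a: "t 1 = 6 * a1" "t 2 = 6 * a2" "t 3 = 6 * a3" "t 4 = 6 * a4"
    using coords(1-4) unfolding dvd_def by blast
  have "3 * (t 5)\<^sup>2 + int d * (t 0)\<^sup>2 - 3 = 36 * (a1 * a2 + a3 * a4)"
    using coords(7) unfolding a by (simp add: algebra_simps)
  then show "36 dvd 3 * (t 5)\<^sup>2 + int d * (t 0)\<^sup>2 - 3"
    by simp
  obtain m where "6 * m = 2 * int d * t 0"
    using coords(6) by (elim dvdE) simp
  then have "int d * t 0 = 3 * m"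
    by linarith
  then show "3 dvd int d * t 0"
    by simp
qed

lemma div_vector_6_sq_congruent:
  assumes t: "div_vector d 6 t" and t': "div_vector d 6 t'" and t0: "6 dvd t 0 - t' 0"
  shows "12 dvd (t 5)\<^sup>2 - (t' 5)\<^sup>2"
proof -
  note R = div_vector_6_residue[OF t] and R' = div_vector_6_residue[OF t']
  obtain k where "t 0 - t' 0 = 6 * k"
    using t0 by (elim dvdE)
  then have k: "t 0 = t' 0 + 6 * k"
    by simp
  obtain m where m: "int d * t' 0 = 3 * m"
    using R'(2) by (elim dvdE)
  have "int d * ((t 0)\<^sup>2 - (t' 0)\<^sup>2) = 36 * (k * (m + int d * k))"
    unfolding k using m by (simp add: power2_eq_square algebra_simps)
  then have "3 * ((t 5)\<^sup>2 - (t' 5)\<^sup>2) = (3 * (t 5)\<^sup>2 + int d * (t 0)\<^sup>2 - 3)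
      - (3 * (t' 5)\<^sup>2 + int d * (t' 0)\<^sup>2 - 3) - 36 * (k * (m + int d * k))"
    by (simp add: algebra_simps)
  also have "36 dvd \<dots>"
    by (rule dvd_diff[OF dvd_diff[OF R(1) R'(1)] dvd_triv_left])
  finally obtain q where "3 * ((t 5)\<^sup>2 - (t' 5)\<^sup>2) = 36 * q"
    by (elim dvdE)
  then have "(t 5)\<^sup>2 - (t' 5)\<^sup>2 = 12 * q"
    by simp
  then show ?thesis
    by simp
qed

lemma div_vector_6_congruent:
  assumes t: "div_vector d 6 t" and t': "div_vector d 6 t'"
    and t0: "6 dvd t 0 - t' 0" and half: "t 5 mod 6 < 3 \<longleftrightarrow> t' 5 mod 6 < 3"
  shows "6 dvd t i - t' i"
proof -
  have t5: "6 dvd t 5 - t' 5"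
    using sq_mod_12_imp_mod_6[OF div_vector_6_sq_congruent[OF t t' t0] half]
    by (simp add: mod_eq_dvd_iff)
  note c = div_vector_coords[OF t] and c' = div_vector_coords[OF t']
  show ?thesis
    by (cases i rule: exhaust_6) (simp_all only: t0 t5 dvd_diff c(1-4) c'(1-4))
qed

text \<open>The boolean components choose between the two residues modulo 6 of \<open>3 u\<^sub>5 / d\<close>, resp.
  \<open>t\<^sub>5\<close>, that have the same square modulo 12.\<close>

definition residue_data_2d :: "nat \<Rightarrow> (6 \<Rightarrow> int) \<Rightarrow> nat set \<times> int \<times> bool" where
  "residue_data_2d d u =
     (root_signature d (u 0), 6 * u 0 mod (12 * int d) div int d, (3 * u 5 div int d) mod 6 < 3)"

definition residue_data_6 :: "(6 \<Rightarrow> int) \<Rightarrow> int \<times> bool" where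
  "residue_data_6 t = (t 0 mod 6, t 5 mod 6 < 3)"

lemma residue_data_2d_range:
  "0 < d \<Longrightarrow> residue_data_2d d u \<in> Pow (prime_factors d) \<times> {0..<12} \<times> UNIV"
  unfolding residue_data_2d_def
  by (intro SigmaI UNIV_I PowI root_signature_subset mod_block_range) simp_all

lemma residue_data_6_range: "residue_data_6 t \<in> {0..<6} \<times> UNIV"
  by (simp add: residue_data_6_def)

lemma residue_data_2d_eq_imp_congruent:
  assumes "0 < d" and u: "div_vector d (2 * int d) u" and u': "div_vector d (2 * int d) u'"
    and eq: "residue_data_2d d u = residue_data_2d d u'"
  shows "2 * int d dvd u i - u' i"
proof -
  have data: "root_signature d (u 0) = root_signature d (u' 0)"
      "6 * u 0 mod (12 * int d) div int d = 6 * u' 0 mod (12 * int d) div int d"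
      "(3 * u 5 div int d) mod 6 < 3 \<longleftrightarrow> (3 * u' 5 div int d) mod 6 < 3"
    using eq by (simp_all add: residue_data_2d_def)
  have "int d dvd 6 * (u 0 - u' 0)"
    using root_signature_eq_imp_dvd[OF assms(1) div_vector_2d_root[OF assms(1) u]
        div_vector_2d_root[OF assms(1) u'] data(1)] .
  then have "12 * int d dvd 6 * u 0 - 6 * u' 0"
    using mod_block_eq_imp_dvd[of "int d" "6 * u 0" "6 * u' 0" 12] assms(1) data(2)
    by (simp add: right_diff_distrib)
  then obtain q where "6 * u 0 - 6 * u' 0 = 12 * int d * q"
    by (elim dvdE)
  then have "u 0 - u' 0 = 2 * int d * q"
    by linarith
  then have "2 * int d dvd u 0 - u' 0"
    by simp
  then show ?thesis
    using div_vector_2d_congruent[OF assms(1) u u' _ data(3)] by blast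
qed

lemma residue_data_6_eq_imp_congruent:
  assumes "div_vector d 6 t" and "div_vector d 6 t'" and "residue_data_6 t = residue_data_6 t'"
  shows "6 dvd t i - t' i"
  using div_vector_6_congruent[OF assms(1,2)] assms(3) by (simp add: residue_data_6_def mod_eq_dvd_iff)

section \<open>Cosets of \<open>\<Gamma>\<close>\<close>

lemma GammaL_mult:
  assumes a: "a \<in> GammaL d" and b: "b \<in> GammaL d"
  shows "a ** b \<in> GammaL d"
proof -
  define v w where "v = (1 / (2 * real d)) *\<^sub>R vecL" and "w = (1 / 6) *\<^sub>R vecW"
  have O: "a \<in> OL d" "b \<in> OL d" "a \<in> spinor_kernel d" "b \<in> spinor_kernel d"
    using a b by (auto simp: GammaL_def OplusL_def)
  have av: "int_vec (a *v v - v)" "int_vec (a *v w - det a *\<^sub>R w)"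
    and bv: "int_vec (b *v v - v)" "int_vec (b *v w - det b *\<^sub>R w)"
    using a b by (auto simp: GammaL_def v_def w_def)
  have "(a ** b) *v v - v = a *v (b *v v - v) + (a *v v - v)"
    by (simp add: matrix_vector_mult_diff_distrib matrix_vector_mul_assoc)
  then have "int_vec ((a ** b) *v v - v)"
    using int_vec_add[OF int_vec_mat[OF OL_int_mat[OF O(1)] bv(1)] av(1)] by (simp only:)
  moreover have "(a ** b) *v w - det (a ** b) *\<^sub>R w
      = a *v (b *v w - det b *\<^sub>R w) + det b *\<^sub>R (a *v w - det a *\<^sub>R w)"
    by (simp add: matrix_vector_mult_diff_distrib matrix_vector_mul_assoc matrix_vector_mult_scaleR
        det_mul scaleR_diff_right algebra_simps)
  then have "int_vec ((a ** b) *v w - det (a ** b) *\<^sub>R w)"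
    using int_vec_add[OF int_vec_mat[OF OL_int_mat[OF O(1)] bv(2)]
        int_vec_scale[OF int_mat_det[OF OL_int_mat[OF O(2)]] av(2)]] by (simp only:)
  ultimately show ?thesis
    using O OL_mult spinor_kernel_mult by (simp add: GammaL_def OplusL_def v_def w_def)
qed

lemma inverse_mult_int_vec:
  fixes n :: nat and a b :: int
  assumes "g' ** g = mat 1" and "int_mat g" "int_mat g'" "int_mat h" and "a * a = 1" and "0 < n"
    and dvd: "\<And>i. int n dvd a * int_col h j i - b * int_col g j i"
  shows "int_vec ((g' ** h) *v ((1 / real n) *\<^sub>R axis j 1)
     - of_int (a * b) *\<^sub>R ((1 / real n) *\<^sub>R axis j 1))"
proof -
  define z where "z = (1 / real n) *\<^sub>R (of_int a *\<^sub>R (h *v axis j 1) - of_int b *\<^sub>R (g *v axis j 1))"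
  have "int_vec z"
    unfolding int_vec_def
  proof
    fix i
    obtain q where "a * int_col h j i - b * int_col g j i = int n * q"
      using dvd[of i] by (elim dvdE)
    then have "of_int a * of_int (int_col h j i) - of_int b * of_int (int_col g j i) = real n * of_int q"
      by (metis of_int_diff of_int_mult of_int_of_nat_eq)
    then have "z $ i = of_int q"
      using assms(2,4,6) by (simp add: z_def int_mat_mult_axis field_simps)
    then show "z $ i \<in> \<int>"
      by simp
  qed
  have "real_of_int a * real_of_int a = 1"
    using assms(5) by (metis of_int_1 of_int_mult)
  moreover have "g' *v (g *v x) = x" for x
    using assms(1) by (simp add: matrix_vector_mul_assoc)
  ultimately have "of_int a *\<^sub>R (g' *v z) = (g' ** h) *v ((1 / real n) *\<^sub>R axis j 1)
     - of_int (a * b) *\<^sub>R ((1 / real n) *\<^sub>R axis j 1)"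
    by (simp add: z_def matrix_vector_mult_diff_distrib matrix_vector_mult_scaleR
        matrix_vector_mul_assoc[symmetric] scaleR_diff_right algebra_simps)
  with \<open>int_vec z\<close> show ?thesis
    using assms(3) by (metis Ints_of_int int_vec_mat int_vec_scale)
qed

lemma OL_inverse_mult_GammaL:
  assumes "0 < d" and g: "g \<in> OL d" and h: "h \<in> OL d" and g': "g' \<in> OL d" "g' ** g = mat 1"
    and spinor: "g \<in> spinor_kernel d \<longleftrightarrow> h \<in> spinor_kernel d"
    and v: "\<And>i. 2 * int d dvd int_col h 0 i - int_col g 0 i"
    and w: "\<And>i. 6 dvd \<lfloor>det h\<rfloor> * int_col h 5 i - \<lfloor>det g\<rfloor> * int_col g 5 i"
  shows "g' ** h \<in> GammaL d"
proof -
  have I: "int_mat g" "int_mat g'" "int_mat h"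
    using g g' h by (simp_all add: OL_int_mat)
  have det: "det (g' ** h) = of_int (\<lfloor>det h\<rfloor> * \<lfloor>det g\<rfloor>)"
    using g h g'(2) by (rule OL_det_left_inverse_mult)
  have "int_vec ((g' ** h) *v ((1 / real (2 * d)) *\<^sub>R axis 0 1)
      - of_int (1 * 1) *\<^sub>R ((1 / real (2 * d)) *\<^sub>R axis 0 1))"
    using v assms(1) by (intro inverse_mult_int_vec[OF g'(2) I(1,2,3)]) simp_all
  then have "int_vec ((g' ** h) *v ((1 / (2 * real d)) *\<^sub>R vecL) - (1 / (2 * real d)) *\<^sub>R vecL)"
    by (simp add: vecL_def)
  moreover have "int_vec ((g' ** h) *v ((1 / real 6) *\<^sub>R axis 5 1)
      - of_int (\<lfloor>det h\<rfloor> * \<lfloor>det g\<rfloor>) *\<^sub>R ((1 / real 6) *\<^sub>R axis 5 1))"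
    using w by (intro inverse_mult_int_vec[OF g'(2) I(1,2,3) OL_det(2)[OF h]]) simp_all
  then have "int_vec ((g' ** h) *v ((1 / 6) *\<^sub>R vecW) - det (g' ** h) *\<^sub>R ((1 / 6) *\<^sub>R vecW))"
    by (simp add: vecW_def det)
  moreover have "g' ** h \<in> spinor_kernel d"
    using OL_left_inverse_mult_spinor_kernel[OF assms(1) g h g'(2) spinor] .
  ultimately show ?thesis
    using OL_mult[OF g'(1) h] by (simp add: GammaL_def OplusL_def)
qed

definition coset_invariant :: "nat \<Rightarrow> real^6^6 \<Rightarrow> bool \<times> (nat set \<times> int \<times> bool) \<times> int \<times> bool" where
  "coset_invariant d g = (g \<in> spinor_kernel d, residue_data_2d d (int_col g 0),
     residue_data_6 (\<lambda>i. \<lfloor>det g\<rfloor> * int_col g 5 i))"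

lemma card_coset_invariant_image:
  assumes "0 < d"
  shows "finite (coset_invariant d ` A)"
    and "card (coset_invariant d ` A) \<le> 576 * 2 ^ card (prime_factors d)"
proof -
  define R :: "(bool \<times> (nat set \<times> int \<times> bool) \<times> int \<times> bool) set"
    where "R = UNIV \<times> (Pow (prime_factors d) \<times> {0..<12} \<times> UNIV) \<times> {0..<6} \<times> UNIV"
  have "coset_invariant d g \<in> R" for g
    unfolding coset_invariant_def R_def
    by (intro SigmaI UNIV_I residue_data_2d_range[OF assms] residue_data_6_range)
  then have sub: "coset_invariant d ` A \<subseteq> R"
    by blast
  have "finite R" and card: "card R = 576 * 2 ^ card (prime_factors d)"
    by (simp_all add: R_def card_cartesian_product card_Pow)
  show "finite (coset_invariant d ` A)"
    by (rule finite_subset[OF sub \<open>finite R\<close>])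
  show "card (coset_invariant d ` A) \<le> 576 * 2 ^ card (prime_factors d)"
    using card_mono[OF \<open>finite R\<close> sub] card by simp
qed

lemma coset_invariant_eq_imp_congruent:
  assumes "0 < d" and g: "g \<in> OL d" and h: "h \<in> OL d"
    and eq: "coset_invariant d g = coset_invariant d h"
  shows "2 * int d dvd int_col h 0 i - int_col g 0 i"
    and "6 dvd \<lfloor>det h\<rfloor> * int_col h 5 i - \<lfloor>det g\<rfloor> * int_col g 5 i"
proof -
  show "2 * int d dvd int_col h 0 i - int_col g 0 i"
    using residue_data_2d_eq_imp_congruent[OF assms(1)
        OL_int_col_div_vector[OF h div_vector_unit_vec_0]
        OL_int_col_div_vector[OF g div_vector_unit_vec_0]] eq
    by (simp add: coset_invariant_def)
  show "6 dvd \<lfloor>det h\<rfloor> * int_col h 5 i - \<lfloor>det g\<rfloor> * int_col g 5 i"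
    using residue_data_6_eq_imp_congruent[
        OF div_vector_sign[OF OL_det(2)[OF h] OL_int_col_div_vector[OF h div_vector_unit_vec_5]]
           div_vector_sign[OF OL_det(2)[OF g] OL_int_col_div_vector[OF g div_vector_unit_vec_5]]] eq
    by (simp add: coset_invariant_def)
qed

lemma coset_invariant_eq_imp_coset_eq:
  assumes "0 < d" and "g \<in> OL d" and "h \<in> OL d"
    and "coset_invariant d g = coset_invariant d h"
  shows "(\<lambda>x. g ** x) ` GammaL d = (\<lambda>x. h ** x) ` GammaL d"
proof -
  have subset: "(\<lambda>x. g ** x) ` GammaL d \<subseteq> (\<lambda>x. h ** x) ` GammaL d"
    if g: "g \<in> OL d" and h: "h \<in> OL d" and eq: "coset_invariant d g = coset_invariant d h" for g h
  proof
    fix z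
    assume "z \<in> (\<lambda>x. g ** x) ` GammaL d"
    then obtain x where x: "x \<in> GammaL d" "z = g ** x"
      by blast
    obtain h' where h': "h' \<in> OL d" "h ** h' = mat 1" "h' ** h = mat 1"
      using OL_inverse[OF h] .
    have "h \<in> spinor_kernel d \<longleftrightarrow> g \<in> spinor_kernel d"
      using eq by (simp add: coset_invariant_def)
    then have "h' ** g \<in> GammaL d"
      by (rule OL_inverse_mult_GammaL[OF assms(1) h g h'(1,3) _
            coset_invariant_eq_imp_congruent[OF assms(1) h g eq[symmetric]]])
    then have "(h' ** g) ** x \<in> GammaL d"
      using x(1) by (rule GammaL_mult)
    moreover have "z = h ** ((h' ** g) ** x)"
      using x(2) h'(2) by (simp add: matrix_mul_assoc)
    ultimately show "z \<in> (\<lambda>x. h ** x) ` GammaL d"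
      by blast
  qed
  show ?thesis
    using subset[of g h] subset[of h g] assms by auto
qed

lemma card_image_le_if_constant_on_fibres:
  assumes "finite (f ` A)" and "\<And>a b. a \<in> A \<Longrightarrow> b \<in> A \<Longrightarrow> f a = f b \<Longrightarrow> F a = F b"
  shows "finite (F ` A)" and "card (F ` A) \<le> card (f ` A)"
proof -
  have "F a = F (inv_into A f (f a))" if "a \<in> A" for a
    using assms(2)[OF that inv_into_into[of "f a" f A]] f_inv_into_f[of "f a" f A] that by simp
  then have "F ` A = (\<lambda>y. F (inv_into A f y)) ` f ` A"
    unfolding image_image by (rule image_cong[OF refl])
  then show "finite (F ` A)" and "card (F ` A) \<le> card (f ` A)"
    using assms(1) by (simp_all add: card_image_le)
qed

theorem lemma2p4:
  fixes d :: nat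
  assumes "d \<ge> 48"
  shows "finite (mat_cosets (OL d) (GammaL d))
       \<and> card (mat_cosets (OL d) (GammaL d)) \<le> 2880 * 2 ^ card (prime_factors (2 * d))"
proof -
  have d: "0 < d" \<comment> \<open>the only use of \<open>d \<ge> 48\<close>\<close>
    using assms by simp
  have cosets: "mat_cosets (OL d) (GammaL d) = (\<lambda>g. (\<lambda>x. g ** x) ` GammaL d) ` OL d"
    by (auto simp: mat_cosets_def)
  have fibres: "\<And>g h. g \<in> OL d \<Longrightarrow> h \<in> OL d \<Longrightarrow> coset_invariant d g = coset_invariant d h
      \<Longrightarrow> (\<lambda>x. g ** x) ` GammaL d = (\<lambda>x. h ** x) ` GammaL d"
    by (rule coset_invariant_eq_imp_coset_eq[OF d])
  note card_image_le_if_constant_on_fibres[of "coset_invariant d" "OL d"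
      "\<lambda>g. (\<lambda>x. g ** x) ` GammaL d", OF card_coset_invariant_image(1)[OF d] fibres]
  moreover note card_coset_invariant_image(2)[OF d, of "OL d"]
  moreover have "card (prime_factors d) \<le> card (prime_factors (2 * d))"
    using d by (intro card_mono) (auto simp: in_prime_factors_iff)
  then have "(2::nat) ^ card (prime_factors d) \<le> 2 ^ card (prime_factors (2 * d))"
    by (rule power_increasing) simp
  ultimately show ?thesis
    unfolding cosets by linarith
qed

end
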